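(* Suppose $F:\mathbb{R}^d\to\mathbb{R}^d$ is weak Minty with parameter $\rho\ge0$ with respect to a point $x_*$ with $F(x_* )=0$, and is $1$-symmetric $(L_0,L_1)$-Lipschitz. Let $\nu$ satisfy $\nu\exp(\nu)=1$ and assume $$\Delta_1:=\frac{\nu}{L_0\left(1+L_1\|x_0-x_*\|e^{L_1\|x_0-x_*\|}\right)}-4\rho>0.$$ Then the extragradient method with step sizes $\gamma_k=\frac{\nu}{L_0+L_1\|F(x_k)\|}$ and $\omega_k=\frac{\gamma_k}2$ satisfies, for all $K\ge0$, $$\min_{0\le k\le K}\|F(\hat x_k)\|^2\le\frac{4L_0\left(1+L_1\exp\left(L_1\|x_0-x_*\|\right)\|x_0-x_*\|\right)\|x_0-x_*\|^2}{\nu\Delta_1(K+1)}.$$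
   Context: Extragradient method (EG): $\hat x_k=x_k-\gamma_kF(x_k)$, $x_{k+1}=x_k-\omega_kF(\hat x_k)$, started from $x_0\in\mathbb{R}^d$. $F$ is $1$-symmetric $(L_0,L_1)$-Lipschitz ($L_0,L_1\ge0$) if for all $x,y$: $\|F(x)-F(y)\|\le\left(L_0+L_1\max_{\theta\in[0,1]}\|F(\theta x+(1-\theta)y)\|\right)\|x-y\|$. Weak Minty with parameter $\rho$: $\langle F(x),x-x_*\rangle\ge-\rho\|F(x)\|^2$ for all $x\in\mathbb{R}^d$. *)

theory Defs
  imports "HOL-Analysis.Analysis"
begin

(* The maximum over the segment is required to be attained; taking a supremum in type real
   instead would yield an unspecified value on segments where F is unbounded. *)
definition one_symmetric_Lipschitz ::
  "((real ^ 'd) \<Rightarrow> (real ^ 'd)) \<Rightarrow> real \<Rightarrow> real \<Rightarrow> bool" where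
  "one_symmetric_Lipschitz F L0 L1 \<longleftrightarrow> L0 \<ge> 0 \<and> L1 \<ge> 0 \<and>
     (\<forall>x y. \<exists>t. is_arg_max (\<lambda>\<theta>::real. norm (F (\<theta> *\<^sub>R x + (1 - \<theta>) *\<^sub>R y))) (\<lambda>\<theta>. \<theta> \<in> {0..1}) t \<and>
        norm (F x - F y) \<le> (L0 + L1 * norm (F (t *\<^sub>R x + (1 - t) *\<^sub>R y))) * norm (x - y))"

definition weak_Minty ::
  "((real ^ 'd) \<Rightarrow> (real ^ 'd)) \<Rightarrow> real ^ 'd \<Rightarrow> real \<Rightarrow> bool" where
  "weak_Minty F xs \<rho> \<longleftrightarrow> (\<forall>x. F x \<bullet> (x - xs) \<ge> - \<rho> * (norm (F x))\<^sup>2)"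

(* Relational, so that the step sizes may depend on the iterates; xh is the sequence of
   extrapolated points and x 0 the starting point. *)
definition extragradient ::
  "((real ^ 'd) \<Rightarrow> (real ^ 'd)) \<Rightarrow> (nat \<Rightarrow> real) \<Rightarrow> (nat \<Rightarrow> real) \<Rightarrow>
   (nat \<Rightarrow> real ^ 'd) \<Rightarrow> (nat \<Rightarrow> real ^ 'd) \<Rightarrow> bool" where
  "extragradient F \<gamma> \<omega> x xh \<longleftrightarrow>
     (\<forall>k. xh k = x k - \<gamma> k *\<^sub>R F (x k) \<and> x (Suc k) = x k - \<omega> k *\<^sub>R F (xh k))"

end

theory Submission
  imports Defs
begin

text \<open>
  Write \<open>c(x) = L0 + L1 * norm (F x)\<close> for the local Lipschitz modulus at \<open>x\<close>.  Two facts carry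
  the proof.

  \<^item> The modulus grows at most exponentially, \<open>c(y) \<le> exp (L1 * norm (x - y)) * c(x)\<close>, so the
    maximum over the segment can be traded for the value at one endpoint
    (\<open>modulus_growth\<close>, \<open>asymmetric_Lipschitz_bound\<close>).  This is a Gronwall argument, done on a
    subdivision of the segment into \<open>n\<close> equal parts: each part contributes a factor
    \<open>1 / (1 - L1 * norm (x - y) / n)\<close>, and the product tends to the exponential.

  \<^item> The step size \<open>\<gamma> = \<nu> / c(x)\<close> with \<open>\<nu> * exp \<nu> = 1\<close> is the one for which this bound yields
    \<open>norm (F x - F xh) \<le> norm (F x)\<close> at the extrapolated point \<open>xh\<close>
    (\<open>extrapolation_deviation\<close>).  Hence \<open>2 * (F xh \<bullet> F x) \<ge> (norm (F xh))\<^sup>2\<close>, and expanding the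
    square of the update gives the descent inequality
    \<open>(norm (x\<^sub>+ - xs))\<^sup>2 \<le> (norm (x - xs))\<^sup>2 - \<gamma> / 4 * (\<gamma> - 4 * \<rho>) * (norm (F xh))\<^sup>2\<close>
    (\<open>extragradient_descent\<close>).

  Since \<open>F xs = 0\<close> makes \<open>c(xs) = L0\<close>, the first fact also bounds \<open>c\<close> on the ball around \<open>xs\<close>
  through \<open>x 0\<close>, so that there \<open>\<gamma>\<close> is at least the fraction \<open>g\<close> in the definition of \<open>\<Delta>1\<close> and
  \<open>\<gamma> - 4 * \<rho> \<ge> \<Delta>1 > 0\<close>.  The descent inequality then keeps the iterates in that ball, and
  telescoping it bounds the sum of \<open>(norm (F (xh k)))\<^sup>2\<close> by \<open>4 * (norm (x 0 - xs))\<^sup>2 / (g * \<Delta>1)\<close>;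
  the minimum is at most the average.
\<close>

section \<open>Growth of one-symmetric Lipschitz operators\<close>

lemma one_symmetric_Lipschitz_nonneg:
  assumes "one_symmetric_Lipschitz F L0 L1"
  shows "L0 \<ge> 0" and "L1 \<ge> 0"
  using assms by (auto simp: one_symmetric_Lipschitz_def)

lemma one_symmetric_Lipschitz_segment_max:
  fixes F :: "real ^ 'd \<Rightarrow> real ^ 'd"
  assumes "one_symmetric_Lipschitz F L0 L1"
  obtains z where "z \<in> closed_segment x y"
    and "\<And>w. w \<in> closed_segment x y \<Longrightarrow> norm (F w) \<le> norm (F z)"
    and "norm (F x - F y) \<le> (L0 + L1 * norm (F z)) * norm (x - y)"
proof -
  obtain t where
    t: "is_arg_max (\<lambda>\<theta>::real. norm (F (\<theta> *\<^sub>R x + (1 - \<theta>) *\<^sub>R y))) (\<lambda>\<theta>. \<theta> \<in> {0..1}) t"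
    and le: "norm (F x - F y) \<le> (L0 + L1 * norm (F (t *\<^sub>R x + (1 - t) *\<^sub>R y))) * norm (x - y)"
    using assms unfolding one_symmetric_Lipschitz_def by blast
  have seg: "closed_segment x y = {\<theta> *\<^sub>R x + (1 - \<theta>) *\<^sub>R y |\<theta>. 0 \<le> \<theta> \<and> \<theta> \<le> 1}"
    by (subst closed_segment_commute) (auto simp: closed_segment_def add.commute)
  show ?thesis
  proof (rule that)
    show "t *\<^sub>R x + (1 - t) *\<^sub>R y \<in> closed_segment x y"
      using t by (auto simp: seg is_arg_max_def)
    show "norm (F w) \<le> norm (F (t *\<^sub>R x + (1 - t) *\<^sub>R y))" if "w \<in> closed_segment x y" for w
      using t that by (auto simp: seg is_arg_max_def not_less)
  qed (rule le)
qed

text \<open>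
  The defining inequality is applied not to \<open>v\<close> but to a point of the segment where \<open>norm (F _)\<close>
  is largest: on the part of the segment before that point the maximum is its own value, so the
  inequality involves only the two endpoint values and can be solved for the larger one.
\<close>
lemma modulus_step:
  fixes F :: "real ^ 'd \<Rightarrow> real ^ 'd"
  assumes L: "one_symmetric_Lipschitz F L0 L1"
  shows "(L0 + L1 * norm (F v)) * (1 - L1 * norm (u - v)) \<le> L0 + L1 * norm (F u)"
proof (cases "L1 * norm (u - v) \<le> 1")
  case False
  have "(L0 + L1 * norm (F v)) * (1 - L1 * norm (u - v)) \<le> 0"
    using False one_symmetric_Lipschitz_nonneg[OF L] by (intro mult_nonneg_nonpos) auto
  also have "0 \<le> L0 + L1 * norm (F u)"
    using one_symmetric_Lipschitz_nonneg[OF L] by simp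
  finally show ?thesis .
next
  case True
  note nn = one_symmetric_Lipschitz_nonneg[OF L]
  obtain z where z: "z \<in> closed_segment u v"
    and zmax: "\<And>w. w \<in> closed_segment u v \<Longrightarrow> norm (F w) \<le> norm (F z)"
    using one_symmetric_Lipschitz_segment_max[OF L, of u v] by blast
  obtain w where w: "w \<in> closed_segment u z"
    and wle: "norm (F u - F z) \<le> (L0 + L1 * norm (F w)) * norm (u - z)"
    using one_symmetric_Lipschitz_segment_max[OF L, of u z] by blast
  have "w \<in> closed_segment u v"
    using w z subset_closed_segment[of u z u v] by auto
  hence wz: "norm (F w) \<le> norm (F z)" by (rule zmax)
  have dist: "norm (u - z) \<le> norm (u - v)"
    using segment_bound(1)[OF z] by (simp add: norm_minus_commute)
  have "norm (F z) - norm (F u) \<le> norm (F u - F z)"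
    by (metis norm_minus_commute norm_triangle_ineq2)
  also have "\<dots> \<le> (L0 + L1 * norm (F z)) * norm (u - v)"
    using wle wz dist nn
    by (elim order_trans) (intro mult_mono add_left_mono mult_left_mono add_nonneg_nonneg; simp)
  finally have "L1 * (norm (F z) - norm (F u)) \<le> L1 * ((L0 + L1 * norm (F z)) * norm (u - v))"
    using nn by (intro mult_left_mono)
  hence main: "(L0 + L1 * norm (F z)) * (1 - L1 * norm (u - v)) \<le> L0 + L1 * norm (F u)"
    by (simp add: algebra_simps)
  have "(L0 + L1 * norm (F v)) * (1 - L1 * norm (u - v))
      \<le> (L0 + L1 * norm (F z)) * (1 - L1 * norm (u - v))"
    using zmax[of v] True nn by (intro mult_right_mono add_left_mono mult_left_mono) auto
  with main show ?thesis by linarith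
qed

text \<open>
  Gronwall's inequality in product form: \<open>n\<close> steps of length \<open>norm (x - y) / n\<close> each cost a factor
  \<open>1 - L1 * norm (x - y) / n\<close>, and \<open>(1 - a / n) ^ n\<close> tends to \<open>exp (- a)\<close>.
\<close>
lemma modulus_growth:
  fixes F :: "real ^ 'd \<Rightarrow> real ^ 'd"
  assumes L: "one_symmetric_Lipschitz F L0 L1"
  shows "L0 + L1 * norm (F y) \<le> exp (L1 * norm (x - y)) * (L0 + L1 * norm (F x))"
proof -
  define a where "a = L1 * norm (x - y)"
  define c where "c z = L0 + L1 * norm (F z)" for z
  have bound: "c y * (1 + (- a) / real n) ^ n \<le> c x" if n: "n > 0" "real n \<ge> a" for n
  proof -
    define p where "p i = x + (real i / real n) *\<^sub>R (y - x)" for i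
    have factor: "1 + (- a) / real n \<ge> 0"
      using n by (simp add: field_simps)
    have "c (p i) * (1 + (- a) / real n) ^ i \<le> c x" for i
    proof (induction i)
      case 0
      show ?case by (simp add: p_def)
    next
      case (Suc i)
      have "p i - p (Suc i) = - ((1 / real n) *\<^sub>R (y - x))"
        by (simp add: p_def add_divide_distrib scaleR_left_distrib)
      hence "norm (p i - p (Suc i)) = norm (x - y) / real n"
        by (simp add: norm_minus_commute)
      hence "c (p (Suc i)) * (1 + (- a) / real n) \<le> c (p i)"
        using modulus_step[OF L, of "p (Suc i)" "p i"] by (simp add: c_def a_def)
      hence "c (p (Suc i)) * (1 + (- a) / real n) * (1 + (- a) / real n) ^ i
          \<le> c (p i) * (1 + (- a) / real n) ^ i"
        using factor by (intro mult_right_mono) auto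
      with Suc.IH show ?case by (simp add: mult.assoc)
    qed
    from this[of n] n show ?thesis by (simp add: p_def)
  qed
  have lim: "(\<lambda>n. c y * (1 + (- a) / real n) ^ n) \<longlonglongrightarrow> c y * exp (- a)"
    by (intro tendsto_intros tendsto_exp_limit_sequentially)
  have "c y * exp (- a) \<le> c x"
  proof (rule LIMSEQ_le_const2[OF lim], intro exI allI impI)
    fix n assume "nat \<lceil>a\<rceil> + 1 \<le> n"
    hence "n > 0" "real n \<ge> a" by linarith+
    thus "c y * (1 + (- a) / real n) ^ n \<le> c x" by (rule bound)
  qed
  hence "c y \<le> exp a * c x"
    by (simp add: exp_minus field_simps)
  thus ?thesis by (simp add: c_def a_def)
qed

lemma asymmetric_Lipschitz_bound:
  fixes F :: "real ^ 'd \<Rightarrow> real ^ 'd"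
  assumes L: "one_symmetric_Lipschitz F L0 L1"
  shows "norm (F x - F y) \<le> exp (L1 * norm (x - y)) * (L0 + L1 * norm (F x)) * norm (x - y)"
proof -
  note nn = one_symmetric_Lipschitz_nonneg[OF L]
  obtain z where z: "z \<in> closed_segment x y"
    and le: "norm (F x - F y) \<le> (L0 + L1 * norm (F z)) * norm (x - y)"
    using one_symmetric_Lipschitz_segment_max[OF L, of x y] by blast
  have dist: "norm (x - z) \<le> norm (x - y)"
    using segment_bound(1)[OF z] by (simp add: norm_minus_commute)
  have "L0 + L1 * norm (F z) \<le> exp (L1 * norm (x - z)) * (L0 + L1 * norm (F x))"
    by (rule modulus_growth[OF L])
  also have "\<dots> \<le> exp (L1 * norm (x - y)) * (L0 + L1 * norm (F x))"
    using dist nn by (intro mult_right_mono) (auto intro: mult_left_mono)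
  finally show ?thesis
    by (rule order_trans[OF le mult_right_mono]) simp
qed

section \<open>One extragradient step\<close>

text \<open>
  Since \<open>L1 * norm (F x)\<close> is at most the modulus at \<open>x\<close>, \<open>L1\<close> times the step length is at most
  \<open>\<nu>\<close>; so the exponential factor is at most \<open>exp \<nu>\<close>, and the modulus at \<open>x\<close> cancels against the step size; \<open>\<nu> * exp \<nu> = 1\<close> makes the remaining constant one.
\<close>
lemma extrapolation_deviation:
  fixes F :: "real ^ 'd \<Rightarrow> real ^ 'd"
  assumes L: "one_symmetric_Lipschitz F L0 L1" and "L0 > 0"
    and \<nu>: "\<nu> * exp \<nu> = 1"
    and \<gamma>: "\<gamma> = \<nu> / (L0 + L1 * norm (F x))"
  shows "norm (F x - F (x - \<gamma> *\<^sub>R F x)) \<le> norm (F x)"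
proof -
  define c where "c = L0 + L1 * norm (F x)"
  note nn = one_symmetric_Lipschitz_nonneg[OF L]
  have c: "c > 0" using nn \<open>L0 > 0\<close> by (simp add: c_def add_pos_nonneg)
  have "\<nu> > 0" using \<nu> by (metis exp_gt_zero zero_less_mult_pos2 zero_less_one)
  have \<gamma>c: "\<gamma> = \<nu> / c" by (simp add: \<gamma> c_def)
  hence "\<gamma> > 0" using c \<open>\<nu> > 0\<close> by simp
  have "L1 * (\<gamma> * norm (F x)) = \<nu> * (L1 * norm (F x) / c)"
    by (simp add: \<gamma>c)
  also have "\<dots> \<le> \<nu> * 1"
    using c \<open>L0 > 0\<close> \<open>\<nu> > 0\<close> by (intro mult_left_mono) (auto simp: c_def)
  finally have small: "L1 * (\<gamma> * norm (F x)) \<le> \<nu>" by simp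
  have "norm (F x - F (x - \<gamma> *\<^sub>R F x)) \<le> exp (L1 * (\<gamma> * norm (F x))) * c * (\<gamma> * norm (F x))"
    using asymmetric_Lipschitz_bound[OF L, of x "x - \<gamma> *\<^sub>R F x"] \<open>\<gamma> > 0\<close> by (simp add: c_def)
  also have "\<dots> \<le> exp \<nu> * c * (\<gamma> * norm (F x))"
    using small c \<open>\<gamma> > 0\<close> by (intro mult_right_mono) auto
  also have "\<dots> = (\<nu> * exp \<nu>) * norm (F x)"
    using c by (simp add: \<gamma>c)
  finally show ?thesis by (simp add: \<nu>)
qed

text \<open>
  Expanding the square leaves the cross term \<open>F xh \<bullet> (x - xs)\<close> with \<open>x - xs = (xh - xs) + \<gamma> F x\<close>.
  Weak Minty bounds the first part; the deviation bound makes the second at least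
  \<open>\<gamma> / 2 * (norm (F xh))\<^sup>2\<close> by polarization.
\<close>
lemma extragradient_descent:
  fixes F :: "real ^ 'd \<Rightarrow> real ^ 'd"
  assumes M: "weak_Minty F xs \<rho>" and "\<gamma> \<ge> 0"
    and dev: "norm (F x - F xh) \<le> norm (F x)"
    and xh: "xh = x - \<gamma> *\<^sub>R F x"
  shows "(norm (x - (\<gamma> / 2) *\<^sub>R F xh - xs))\<^sup>2
    \<le> (norm (x - xs))\<^sup>2 - \<gamma> / 4 * (\<gamma> - 4 * \<rho>) * (norm (F xh))\<^sup>2"
proof -
  have "(norm (F x - F xh))\<^sup>2 \<le> (norm (F x))\<^sup>2"
    using dev by (intro power_mono) auto
  hence "(norm (F xh))\<^sup>2 / 2 \<le> F xh \<bullet> F x"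
    by (simp add: power2_norm_eq_inner inner_diff_left inner_diff_right inner_commute)
  hence "\<gamma> * ((norm (F xh))\<^sup>2 / 2) \<le> \<gamma> * (F xh \<bullet> F x)"
    using \<open>\<gamma> \<ge> 0\<close> by (rule mult_left_mono)
  moreover have "- \<rho> * (norm (F xh))\<^sup>2 \<le> F xh \<bullet> (xh - xs)"
    using M by (simp add: weak_Minty_def)
  moreover have "F xh \<bullet> (x - xs) = F xh \<bullet> (xh - xs) + \<gamma> * (F xh \<bullet> F x)"
    by (simp add: xh inner_diff_right)
  ultimately have "(\<gamma> / 2 - \<rho>) * (norm (F xh))\<^sup>2 \<le> F xh \<bullet> (x - xs)"
    by (simp add: algebra_simps)
  hence cross: "\<gamma> * ((\<gamma> / 2 - \<rho>) * (norm (F xh))\<^sup>2) \<le> \<gamma> * (F xh \<bullet> (x - xs))"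
    using \<open>\<gamma> \<ge> 0\<close> by (rule mult_left_mono)
  have "x - (\<gamma> / 2) *\<^sub>R F xh - xs = (x - xs) - (\<gamma> / 2) *\<^sub>R F xh"
    by simp
  hence "(norm (x - (\<gamma> / 2) *\<^sub>R F xh - xs))\<^sup>2
      = (norm (x - xs))\<^sup>2 - \<gamma> * (F xh \<bullet> (x - xs)) + \<gamma>\<^sup>2 / 4 * (norm (F xh))\<^sup>2"
    unfolding power2_norm_eq_inner
    by (simp add: inner_diff_left inner_diff_right inner_commute algebra_simps power2_eq_square)
  with cross show ?thesis
    by (simp add: algebra_simps power2_eq_square)
qed

section \<open>Convergence rate\<close>

lemma modulus_bound_near_zero:
  fixes F :: "real ^ 'd \<Rightarrow> real ^ 'd"
  assumes L: "one_symmetric_Lipschitz F L0 L1" and "F xs = 0" and D: "norm (x - xs) \<le> D"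
  shows "L0 + L1 * norm (F x) \<le> L0 * (1 + L1 * D * exp (L1 * D))"
proof -
  note nn = one_symmetric_Lipschitz_nonneg[OF L]
  have "norm (F x) \<le> exp (L1 * norm (x - xs)) * L0 * norm (x - xs)"
    using asymmetric_Lipschitz_bound[OF L, of xs x] \<open>F xs = 0\<close> by (simp add: norm_minus_commute)
  also have "\<dots> \<le> exp (L1 * D) * L0 * D"
    using D nn by (intro mult_mono) (auto intro: mult_left_mono)
  finally have "L1 * norm (F x) \<le> L1 * (exp (L1 * D) * L0 * D)"
    using nn by (intro mult_left_mono)
  thus ?thesis by (simp add: algebra_simps)
qed

theorem theorem4p7:
  fixes F :: "(real ^ 'd) \<Rightarrow> (real ^ 'd)"
    and xs :: "real ^ 'd"
    and x xh :: "nat \<Rightarrow> real ^ 'd"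
    and \<gamma> \<omega> :: "nat \<Rightarrow> real"
    and L0 L1 \<rho> \<nu> \<Delta>1 :: real
  assumes "\<rho> \<ge> 0"
    and "F xs = 0"
    and "weak_Minty F xs \<rho>"
    and "one_symmetric_Lipschitz F L0 L1"
    and "\<nu> * exp \<nu> = 1"
    and "\<Delta>1 = \<nu> / (L0 * (1 + L1 * norm (x 0 - xs) * exp (L1 * norm (x 0 - xs)))) - 4 * \<rho>"
    and "\<Delta>1 > 0"
    and "\<And>k. \<gamma> k = \<nu> / (L0 + L1 * norm (F (x k)))"
    and "\<And>k. \<omega> k = \<gamma> k / 2"
    and "extragradient F \<gamma> \<omega> x xh"
  shows "\<forall>K::nat. (MIN k\<in>{0..K}. (norm (F (xh k)))\<^sup>2) \<le>
     4 * L0 * (1 + L1 * exp (L1 * norm (x 0 - xs)) * norm (x 0 - xs)) * (norm (x 0 - xs))\<^sup>2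
       / (\<nu> * \<Delta>1 * (real K + 1))"
proof -
  define D where "D = norm (x 0 - xs)"
  define B where "B = L0 * (1 + L1 * D * exp (L1 * D))"
  note L = assms(4)
  note nn = one_symmetric_Lipschitz_nonneg[OF L]
  have "\<nu> > 0" using assms(5) by (metis exp_gt_zero zero_less_mult_pos2 zero_less_one)
  have \<Delta>: "\<Delta>1 = \<nu> / B - 4 * \<rho>" using assms(6) by (simp add: B_def D_def)
  \<comment> \<open>With \<open>L0 = 0\<close> the quotient in \<open>\<Delta>1\<close> would be zero by the convention for division, contradicting \<open>\<Delta>1 > 0\<close>.\<close>
  have "L0 > 0"
  proof -
    have "L0 \<noteq> 0"
      using assms(1,7) \<Delta> by (auto simp: B_def)
    thus ?thesis using nn by simp
  qed
  have "D \<ge> 0" by (simp add: D_def)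
  hence "B > 0"
    using nn \<open>L0 > 0\<close> unfolding B_def by (intro mult_pos_pos add_pos_nonneg) auto
  have xh: "xh k = x k - \<gamma> k *\<^sub>R F (x k)" and x: "x (Suc k) = x k - (\<gamma> k / 2) *\<^sub>R F (xh k)" for k
    using assms(9,10) by (auto simp: extragradient_def)
  have "L0 + L1 * norm (F (x k)) > 0" for k
    using nn \<open>L0 > 0\<close> by (intro add_pos_nonneg) auto
  hence \<gamma>_pos: "\<gamma> k > 0" for k
    using assms(8) \<open>\<nu> > 0\<close> by simp
  have step: "(norm (x (Suc k) - xs))\<^sup>2
      \<le> (norm (x k - xs))\<^sup>2 - \<gamma> k / 4 * (\<gamma> k - 4 * \<rho>) * (norm (F (xh k)))\<^sup>2" for k
  proof -
    have "norm (F (x k) - F (xh k)) \<le> norm (F (x k))"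
      using extrapolation_deviation[OF L \<open>L0 > 0\<close> assms(5) assms(8)[of k]] by (simp add: xh)
    from extragradient_descent[OF assms(3) less_imp_le[OF \<gamma>_pos] this xh] show ?thesis
      by (simp add: x)
  qed
  have \<gamma>_lower: "\<nu> / B \<le> \<gamma> k" if "norm (x k - xs) \<le> D" for k
  proof -
    have "L0 + L1 * norm (F (x k)) \<le> B"
      unfolding B_def by (rule modulus_bound_near_zero[OF L assms(2) that])
    thus ?thesis
      using \<open>\<nu> > 0\<close> \<open>B > 0\<close> \<open>L0 + L1 * norm (F (x k)) > 0\<close> assms(8)[of k]
      by (auto intro!: divide_left_mono)
  qed
  have descent: "(norm (x (Suc k) - xs))\<^sup>2
      \<le> (norm (x k - xs))\<^sup>2 - \<nu> / B * \<Delta>1 / 4 * (norm (F (xh k)))\<^sup>2"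
    if "norm (x k - xs) \<le> D" for k
  proof -
    have "\<nu> / B * \<Delta>1 \<le> \<gamma> k * (\<gamma> k - 4 * \<rho>)"
      using \<gamma>_lower[OF that] \<Delta> \<gamma>_pos[of k] assms(7) by (intro mult_mono) auto
    hence "\<nu> / B * \<Delta>1 / 4 * (norm (F (xh k)))\<^sup>2
        \<le> \<gamma> k / 4 * (\<gamma> k - 4 * \<rho>) * (norm (F (xh k)))\<^sup>2"
      by (intro mult_right_mono) auto
    with step[of k] show ?thesis by linarith
  qed
  define q where "q = \<nu> / B * \<Delta>1 / 4"
  have "q > 0" using \<open>\<nu> > 0\<close> \<open>B > 0\<close> assms(7) by (simp add: q_def)
  have ball: "norm (x k - xs) \<le> D" for k
  proof (induction k)
    case 0
    show ?case by (simp add: D_def)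
  next
    case (Suc k)
    have "0 \<le> q * (norm (F (xh k)))\<^sup>2"
      using \<open>q > 0\<close> by simp
    hence "(norm (x (Suc k) - xs))\<^sup>2 \<le> (norm (x k - xs))\<^sup>2"
      using descent[OF Suc.IH] unfolding q_def by linarith
    hence "norm (x (Suc k) - xs) \<le> norm (x k - xs)"
      by (simp add: power_mono_iff)
    with Suc.IH show ?case by linarith
  qed
  have telescope: "q * (\<Sum>k<n. (norm (F (xh k)))\<^sup>2) \<le> D\<^sup>2 - (norm (x n - xs))\<^sup>2" for n
  proof (induction n)
    case 0
    show ?case by (simp add: D_def)
  next
    case (Suc n)
    with descent[OF ball[of n]] show ?case
      unfolding q_def[symmetric] by (simp add: distrib_left)
  qed
  show ?thesis
  proof
    fix K :: nat
    define m where "m = (MIN k\<in>{0..K}. (norm (F (xh k)))\<^sup>2)"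
    have "real (card {..<Suc K}) * m \<le> (\<Sum>k<Suc K. (norm (F (xh k)))\<^sup>2)"
      unfolding m_def by (rule sum_bounded_below) (auto intro!: Min_le)
    hence "q * ((real K + 1) * m) \<le> q * (\<Sum>k<Suc K. (norm (F (xh k)))\<^sup>2)"
      using \<open>q > 0\<close> by (intro mult_left_mono) (auto simp: add.commute)
    also have "\<dots> \<le> D\<^sup>2"
      using telescope[of "Suc K"] zero_le_power2[of "norm (x (Suc K) - xs)"] by linarith
    finally have "m * (q * (real K + 1)) \<le> D\<^sup>2"
      by (simp add: mult_ac)
    hence "m \<le> D\<^sup>2 / (q * (real K + 1))"
      using \<open>q > 0\<close> by (subst pos_le_divide_eq) auto
    also have "\<dots> = 4 * B * D\<^sup>2 / (\<nu> * \<Delta>1 * (real K + 1))"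
      by (simp add: q_def)
    also have "\<dots> = 4 * L0 * (1 + L1 * exp (L1 * D) * D) * D\<^sup>2 / (\<nu> * \<Delta>1 * (real K + 1))"
      by (simp add: B_def mult_ac)
    finally show "(MIN k\<in>{0..K}. (norm (F (xh k)))\<^sup>2) \<le>
        4 * L0 * (1 + L1 * exp (L1 * norm (x 0 - xs)) * norm (x 0 - xs)) * (norm (x 0 - xs))\<^sup>2
          / (\<nu> * \<Delta>1 * (real K + 1))"
      by (simp add: m_def D_def)
  qed
qed

end
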